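(* As $n\to\infty$, $$\|p_n\|_1 \sim \frac{8}{(2\pi)^{n+1}}\qquad\text{and}\qquad \|q_{2n}\|_1 \sim \frac{2}{(2\pi)^{2n}}.$$
   Context: The Bernoulli polynomials $B_n(x)$ are defined by $B_0(x)=1$ and, for $n\ge1$, $\frac{d}{dx}B_n(x)=nB_{n-1}(x)$ together with $\int_0^1 B_n(x)\,dx=0$; the Bernoulli numbers are $B_n=B_n(0)$. Put $p_n(x)=B_n(x)/n!$ and $q_n(x)=B_n(x)/n!-B_n/n!$. For a polynomial $p$, $\|p\|_1=\int_0^1|p(x)|\,dx$. Here $u_n\sim v_n$ means $u_n/v_n\to1$ as $n\to\infty$. *)

theory Defs
  imports
    "HOL-Analysis.Analysis"
    "HOL-Computational_Algebra.Polynomial"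
    "HOL-Library.Landau_Symbols"
begin

text \<open>The description operator below is justified by \<open>bernoulli_poly_step_ex1\<close>.\<close>

primrec bernoulli_poly :: "nat \<Rightarrow> real poly" where
  "bernoulli_poly 0 = 1"
| "bernoulli_poly (Suc n) =
     (THE p. pderiv p = smult (of_nat (Suc n)) (bernoulli_poly n) \<and>
             integral {0..1} (poly p) = 0)"

definition bernoulli_number :: "nat \<Rightarrow> real" where
  "bernoulli_number n = poly (bernoulli_poly n) 0"

definition bernoulli_p :: "nat \<Rightarrow> real poly" where
  "bernoulli_p n = smult (1 / fact n) (bernoulli_poly n)"

definition bernoulli_q :: "nat \<Rightarrow> real poly" where
  "bernoulli_q n = smult (1 / fact n) (bernoulli_poly n) - [:bernoulli_number n / fact n:]"

definition poly_L1_norm :: "real poly \<Rightarrow> real" where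
  "poly_L1_norm p = integral {0..1} (\<lambda>x. \<bar>poly p x\<bar>)"

lemma pderiv_surj: "\<exists>p. pderiv p = (q :: real poly)"
proof -
  let ?m = "\<lambda>i. monom (coeff q i / real (Suc i)) (Suc i)"
  have "pderiv (\<Sum>i\<le>degree q. ?m i) = (\<Sum>i\<le>degree q. monom (coeff q i) i)"
    by (simp add: higher_pderiv_sum[of 1, simplified] pderiv_monom del: of_nat_Suc)
  then show ?thesis
    by (metis poly_as_sum_of_monoms)
qed

lemma integral_poly_add_const:
  "integral {0..1} (poly (p + [:c:])) = integral {0..1} (poly p) + (c :: real)"
proof -
  have "integral {0..1} (\<lambda>x. poly p x + c) = integral {0..1} (poly p) + integral {0..1} (\<lambda>x::real. c)"
    by (intro Henstock_Kurzweil_Integration.integral_add integrable_continuous_real continuous_intros)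
  moreover have "poly (p + [:c:]) = (\<lambda>x. poly p x + c)" by auto
  ultimately show ?thesis by simp
qed

lemma bernoulli_poly_step_ex1:
  "\<exists>!p :: real poly. pderiv p = q \<and> integral {0..1} (poly p) = 0"
proof -
  obtain r where r: "pderiv r = q" using pderiv_surj by blast
  let ?p = "r + [:- integral {0..1} (poly r):]"
  show ?thesis
  proof (rule ex1I[of _ ?p])
    show "pderiv ?p = q \<and> integral {0..1} (poly ?p) = 0"
      by (simp only: integral_poly_add_const) (simp add: pderiv_add r pderiv_pCons)
  next
    fix p assume p: "pderiv p = q \<and> integral {0..1} (poly p) = 0"
    have "pderiv (p - r) = 0" using p r by (simp add: pderiv_diff)
    then obtain c where "p - r = [:c:]"
      by (metis degree_0_id pderiv_eq_0_iff degree_eq_zeroE)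
    then have c: "p = r + [:c:]" by (simp add: algebra_simps)
    then have "c = - integral {0..1} (poly r)"
      using p integral_poly_add_const[of r c] by simp
    then show "p = ?p" using c by simp
  qed
qed

lemma pderiv_bernoulli_poly_Suc:
    "pderiv (bernoulli_poly (Suc n)) = smult (of_nat (Suc n)) (bernoulli_poly n)"
  and integral_bernoulli_poly_Suc:
    "integral {0..1} (poly (bernoulli_poly (Suc n))) = 0"
  using theI'[OF bernoulli_poly_step_ex1[of "smult (of_nat (Suc n)) (bernoulli_poly n)"]]
  by simp_all

end

theory Submission
  imports Defs "HOL-Complex_Analysis.Complex_Analysis"
begin

text \<open>Write $b_n = B_n / n!$. The leading Fourier term of $p_n$ is $-2 (2\pi)^{-n} c_n$ with
  $c_n(x) = \cos(2\pi x - n\pi/2)$. Integration by parts gives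
  $\int_0^1 p_n^2 = (-1)^{n-1} b_{2n}$ and $\int_0^1 p_n c_n = -(2\pi)^{-n}$, so that
  $\int_0^1 ((2\pi)^n p_n + 2 c_n)^2 = (-1)^{n-1} (2\pi)^{2n} b_{2n} - 2$, and no Fourier series is
  needed: everything reduces to $(-1)^n (2\pi)^{2n} b_{2n} \to -2$.

  For this limit, $\phi(z) = z (z^2 + 4\pi^2) / (e^z - 1)$ extends holomorphically to
  $|z| < 4\pi$ and $\phi(\pm 2\pi i) = -8\pi^2$. Its Taylor coefficients are
  $4\pi^2 b_n + b_{n-2}$, so the even part of the series at $2\pi i$ telescopes, with partial sums
  $4\pi^2 (-1)^n (2\pi)^{2n} b_{2n}$.\<close>

section \<open>Boundary values, coefficients and generating function of
  \<open>bernoulli_p\<close>\<close>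

text \<open>$B_n / n!$, not the Bernoulli number $B_n$ itself.\<close>
abbreviation bern :: "nat \<Rightarrow> real" where
  "bern n \<equiv> poly (bernoulli_p n) 0"

lemma bernoulli_p_0 [simp]: "bernoulli_p 0 = 1"
  by (simp add: bernoulli_p_def)

lemma pderiv_bernoulli_p: "pderiv (bernoulli_p (Suc n)) = bernoulli_p n"
  by (simp add: bernoulli_p_def pderiv_smult pderiv_bernoulli_poly_Suc del: bernoulli_poly.simps)

lemma integral_bernoulli_p: "integral {0..1} (poly (bernoulli_p (Suc n))) = 0"
proof -
  have "poly (bernoulli_p (Suc n)) = (\<lambda>x. (1 / fact (Suc n)) * poly (bernoulli_poly (Suc n)) x)"
    by (auto simp: bernoulli_p_def fun_eq_iff simp del: bernoulli_poly.simps)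
  then show ?thesis
    using integral_bernoulli_poly_Suc[of n] by (simp del: bernoulli_poly.simps)
qed

text \<open>The increment over the unit interval is the integral of \<open>bernoulli_p n\<close>,
  which vanishes unless n = 0. This controls all boundary terms in the integrations by parts
  below.\<close>

lemma bernoulli_p_at_1:
  "poly (bernoulli_p (Suc n)) 1 = bern (Suc n) + (if n = 0 then 1 else 0)"
proof -
  have "((\<lambda>x. poly (bernoulli_p n) x) has_integral
          (poly (bernoulli_p (Suc n)) 1 - poly (bernoulli_p (Suc n)) 0)) {0..1}"
    by (rule fundamental_theorem_of_calculus)
       (auto intro!: has_field_derivative_at_within poly_DERIV
             simp: pderiv_bernoulli_p[of n, symmetric] has_real_derivative_iff_has_vector_derivative[symmetric])
  then have "integral {0..1} (poly (bernoulli_p n)) = poly (bernoulli_p (Suc n)) 1 - bern (Suc n)"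
    by (simp add: integral_unique)
  moreover have "integral {0..1} (poly (bernoulli_p n)) = (if n = 0 then 1 else 0)"
    using integral_bernoulli_p by (cases n) (auto simp: fun_eq_iff one_pCons cong: integral_cong)
  ultimately show ?thesis by simp
qed

text \<open>Differentiating k times takes \<open>bernoulli_p (n + k)\<close> to
  \<open>bernoulli_p n\<close> and turns its k-th coefficient, times k!, into the constant
  term.\<close>

lemma coeff_bernoulli_p: "coeff (bernoulli_p (n + k)) k = bern n / fact k"
proof (induction k)
  case 0
  then show ?case by (simp add: poly_0_coeff_0)
next
  case (Suc k)
  have "real (Suc k) * coeff (bernoulli_p (n + Suc k)) (Suc k) = coeff (bernoulli_p (n + k)) k"
    using arg_cong[OF pderiv_bernoulli_p[of "n + k"], of "\<lambda>p. coeff p k"]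
    by (simp add: coeff_pderiv)
  then have "coeff (bernoulli_p (n + Suc k)) (Suc k) = coeff (bernoulli_p (n + k)) k / real (Suc k)"
    by (metis nonzero_mult_div_cancel_left of_nat_eq_0_iff nat.distinct(2))
  then show ?case by (simp only: Suc fact_Suc divide_divide_eq_left of_nat_mult mult.commute)
qed

lemma degree_bernoulli_p: "degree (bernoulli_p n) \<le> n"
proof (induction n)
  case (Suc n)
  then show ?case
    using degree_pderiv[of "bernoulli_p (Suc n)"] by (simp add: pderiv_bernoulli_p)
qed simp

text \<open>The value at 1 is the sum of the coefficients, and so a coefficient of the Cauchy
  product of the series of \<open>bern\<close> with exp.\<close>

lemma bernoulli_p_at_1_sum: "poly (bernoulli_p n) 1 = (\<Sum>k\<le>n. bern (n - k) / fact k)"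
proof -
  have "poly (bernoulli_p n) 1 = (\<Sum>k\<le>n. coeff (bernoulli_p n) k)"
    unfolding poly_altdef using degree_bernoulli_p[of n]
    by (simp add: sum.mono_neutral_left[of "{..n}" "{..degree (bernoulli_p n)}"] coeff_eq_0)
  also have "\<dots> = (\<Sum>k\<le>n. bern (n - k) / fact k)"
    by (intro sum.cong refl) (metis atMost_iff coeff_bernoulli_p le_add_diff_inverse2)
  finally show ?thesis .
qed

text \<open>The generating function z/(e^z - 1), multiplied out because e^z - 1 has no constant
  term. The n-th coefficient on the left is the difference of the values of
  \<open>bernoulli_p n\<close> at 1 and 0, which is nonzero only for n = 1.\<close>

lemma bern_fps:
  "Abs_fps (\<lambda>n. complex_of_real (bern n)) * (fps_exp 1 - 1) = fps_X"
proof (rule fps_ext)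
  fix n
  let ?B = "Abs_fps (\<lambda>n. complex_of_real (bern n))"
  have "fps_nth (?B * fps_exp 1) n = of_real (poly (bernoulli_p n) 1)"
    by (subst mult.commute)
       (simp add: fps_mult_nth bernoulli_p_at_1_sum atLeast0AtMost field_simps)
  then show "fps_nth (?B * (fps_exp 1 - 1)) n = fps_nth fps_X n"
    using bernoulli_p_at_1
    by (cases n) (auto simp: right_diff_distrib)
qed

section \<open>Limit of the scaled even Bernoulli numbers by removing singularities\<close>

text \<open>The quotient is the reciprocal of the difference quotient of exp at b, whose limit is
  exp b = 1.\<close>

lemma tendsto_div_exp_minus_1:
  fixes b :: complex
  assumes "exp b = 1"
  shows "(\<lambda>z. (z - b) / (exp z - 1)) \<midarrow>b\<rightarrow> 1"
proof -
  have "(exp has_field_derivative 1) (at b)"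
    using DERIV_exp[of b] assms by simp
  then have "(\<lambda>z. (exp z - 1) / (z - b)) \<midarrow>b\<rightarrow> 1"
    by (simp add: has_field_derivative_iff assms)
  from tendsto_inverse[OF this] show ?thesis by simp
qed

lemma exp_eq_1_in_ball:
  assumes "exp z = 1" "norm z < 4 * pi"
  shows "z \<in> {0, 2 * pi * \<i>, - (2 * pi * \<i>)}"
proof -
  obtain n :: int where n: "Re z = 0" "Im z = of_int (2 * n) * pi"
    using assms(1) by (auto simp: exp_eq_1)
  have "\<bar>Im z\<bar> < 4 * pi"
    using assms(2) abs_Im_le_cmod[of z] by linarith
  then have "\<bar>of_int n\<bar> * pi < 2 * pi" unfolding n by (simp add: abs_mult)
  then have "\<bar>real_of_int n\<bar> < 2" by simp
  then have "n \<in> {-1, 0, 1}" by auto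
  then show ?thesis using n by (auto simp: complex_eq_iff)
qed

text \<open>$z (z^2 + 4\pi^2) / (e^z - 1)$ with its singularities at $0$ and $\pm 2\pi i$ removed.\<close>
definition bern_aux :: "complex \<Rightarrow> complex" where
  "bern_aux z = (if z = 0 then 4 * of_real pi ^ 2 else if z\<^sup>2 = - (4 * of_real pi ^ 2) then - 8 * of_real pi ^ 2
     else z * (z\<^sup>2 + 4 * of_real pi ^ 2) / (exp z - 1))"

text \<open>In this disc 1/(e^z - 1) has only the simple poles 0 and \<plusminus>2 pi i, each
  cancelled by a zero of the cubic numerator. Continuity of \<open>bern_aux\<close> at these points
  then suffices.\<close>

lemma bern_aux_holomorphic: "bern_aux holomorphic_on ball 0 (4 * pi)"
proof (rule no_isolated_singularity')
  let ?a = "2 * pi * \<i>" let ?K = "{0, 2 * pi * \<i>, - (2 * pi * \<i>)}"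
  have sq: "z\<^sup>2 = - (4 * of_real pi ^ 2) \<longleftrightarrow> z = ?a \<or> z = - ?a" for z :: complex
    using power2_eq_iff[of z ?a] by (simp add: power_mult_distrib)
  have ne: "exp z \<noteq> 1" if "z \<in> ball 0 (4*pi) - ?K" for z
    using exp_eq_1_in_ball[of z] that by auto
  show "bern_aux holomorphic_on ball 0 (4 * pi) - ?K"
  proof (rule holomorphic_transform[of "\<lambda>z. z * (z\<^sup>2 + 4 * of_real pi ^ 2) / (exp z - 1)"])
    show "(\<lambda>z. z * (z\<^sup>2 + 4 * of_real pi ^ 2) / (exp z - 1)) holomorphic_on ball 0 (4 * pi) - ?K"
      using ne by (intro holomorphic_intros) auto
  qed (auto simp: bern_aux_def sq)
  have ea: "exp ?a = 1" "exp (- ?a) = 1"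
    by (simp_all add: exp_minus del: mult_minus_left)
  show "(bern_aux \<longlongrightarrow> bern_aux b) (at b within ball 0 (4 * pi))" if "b \<in> ?K" for b
  proof -
    have bin: "b \<in> ball 0 (4 * pi)" "exp b = 1" using that ea by (auto simp: norm_mult)
    \<comment> \<open>The cofactor of z - b in the numerator; for b = \<plusminus>2 pi i one has z^2
      + 4 pi^2 = (z - b)(z + b).\<close>
    define g where "g = (\<lambda>z. if b = 0 then z\<^sup>2 + 4 * of_real pi ^ 2 else z * (z + b))"
    have fact: "z * (z\<^sup>2 + 4 * of_real pi ^ 2) = (z - b) * g z" for z
      using that by (auto simp: g_def algebra_simps power2_eq_square)
    have "g \<midarrow>b\<rightarrow> g b" unfolding g_def by (auto intro!: tendsto_eq_intros)
    moreover have "g b = bern_aux b"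
      using that by (auto simp: g_def bern_aux_def power2_eq_square)
    ultimately have "(\<lambda>z. (z - b) / (exp z - 1) * g z) \<midarrow>b\<rightarrow> bern_aux b"
      using tendsto_mult[OF tendsto_div_exp_minus_1[OF bin(2)], of g "g b"] by simp
    \<comment> \<open>Close to b, but not at b, all three exceptional points are avoided, so
      \<open>bern_aux\<close> is given by the plain quotient.\<close>
    moreover have "open (- (?K - {b}))"
      by (intro open_Compl finite_imp_closed) auto
    then have "eventually (\<lambda>z. z \<in> - (?K - {b})) (at b)"
      by (rule eventually_at_in_open') auto
    then have "eventually (\<lambda>z. (z - b) / (exp z - 1) * g z = bern_aux z) (at b)"
      using eventually_neq_at_within[of b b UNIV]
      by eventually_elim (use that in \<open>auto simp: bern_aux_def sq fact\<close>)
    ultimately show ?thesis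
      using bin(1) by (subst at_within_open[of _ "ball 0 (4*pi)"])
        (auto elim: Lim_transform_eventually)
  qed
qed auto

text \<open>Both series agree after multiplication by \<open>fps_exp 1 - 1\<close>, which is nonzero
  and can be cancelled since formal power series over a field form an integral domain.\<close>

lemma bern_aux_fps:
  "bern_aux has_fps_expansion
     (fps_X\<^sup>2 + fps_const (4 * of_real pi ^ 2)) * Abs_fps (\<lambda>n. complex_of_real (bern n))"
proof -
  let ?F = "fps_expansion bern_aux 0" and ?B = "Abs_fps (\<lambda>n. complex_of_real (bern n))"
  let ?Q = "fps_X\<^sup>2 + fps_const (4 * of_real pi ^ 2) :: complex fps"
  have F: "bern_aux has_fps_expansion ?F"
    by (rule has_fps_expansion_fps_expansion[OF _ _ bern_aux_holomorphic]) auto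
  have L: "(\<lambda>z. bern_aux z * (exp z - 1)) has_fps_expansion ?F * (fps_exp 1 - 1)"
    by (intro fps_expansion_intros F)
  have Q: "(\<lambda>z. z * (z\<^sup>2 + 4 * of_real pi ^ 2)) has_fps_expansion fps_X * ?Q"
    by (intro fps_expansion_intros)
  \<comment> \<open>Within radius 2 pi the only exceptional point is 0, where both sides of the
    product identity vanish.\<close>
  have "eventually (\<lambda>z. z \<in> ball 0 (2 * pi)) (nhds (0::complex))"
    by (rule eventually_nhds_in_open) auto
  then have "eventually (\<lambda>z. z * (z\<^sup>2 + 4 * of_real pi ^ 2) = bern_aux z * (exp z - 1)) (nhds 0)"
  proof eventually_elim
    case (elim z)
    have z: "norm z < 2 * pi" "norm z < 4 * pi" using elim pi_gt_zero by (simp_all, linarith)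
    have "z\<^sup>2 \<noteq> - (4 * of_real pi ^ 2)"
    proof
      assume "z\<^sup>2 = - (4 * of_real pi ^ 2)"
      then have "norm (z\<^sup>2) = norm (- (4 * of_real pi ^ 2) :: complex)" by (rule arg_cong)
      then have "(norm z)\<^sup>2 = (2 * pi)\<^sup>2" by (simp add: norm_power norm_mult power_mult_distrib)
      then have "norm z = 2 * pi" by (subst (asm) power2_eq_iff_nonneg) auto
      then show False using z by simp
    qed
    moreover have "exp z \<noteq> 1" if "z \<noteq> 0"
      using exp_eq_1_in_ball[of z] that z by (auto simp: norm_mult simp del: of_real_mult)
    ultimately show ?case by (auto simp: bern_aux_def)
  qed
  then have "(\<lambda>z. z * (z\<^sup>2 + 4 * of_real pi ^ 2)) has_fps_expansion ?F * (fps_exp 1 - 1) \<longleftrightarrow>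
      (\<lambda>z. bern_aux z * (exp z - 1)) has_fps_expansion ?F * (fps_exp 1 - 1)"
    by (rule has_fps_expansion_cong[OF _ refl])
  with L have "(\<lambda>z. z * (z\<^sup>2 + 4 * of_real pi ^ 2)) has_fps_expansion ?F * (fps_exp 1 - 1)"
    by (simp only:)
  from fps_expansion_unique_complex[OF this Q] have "?F * (fps_exp 1 - 1) = fps_X * ?Q" .
  also have "\<dots> = ?Q * (?B * (fps_exp 1 - 1))"
    unfolding bern_fps by (rule mult.commute)
  also have "\<dots> = ?Q * ?B * (fps_exp 1 - 1)"
    by (simp only: mult.assoc)
  finally have "?F * (fps_exp 1 - 1) = ?Q * ?B * (fps_exp 1 - 1)" .
  moreover have "fps_nth (fps_exp 1 - 1 :: complex fps) 1 \<noteq> 0" by simp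
  then have "fps_exp 1 - 1 \<noteq> (0 :: complex fps)" by force
  ultimately have "?F = ?Q * ?B" by (rule mult_right_cancel[THEN iffD1, rotated])
  with F show ?thesis by (simp only:)
qed

text \<open>The points \<plusminus>2 pi i are poles of z/(e^z - 1) but lie inside the disc where
  \<open>bern_aux\<close> is holomorphic, so its Taylor series converges there.\<close>

lemma bern_even_tendsto: "(\<lambda>n. (-1) ^ n * ((2 * pi) ^ (2 * n) * bern (2 * n))) \<longlonglongrightarrow> - 2"
proof -
  let ?a = "2 * pi * \<i>"
  let ?B = "Abs_fps (\<lambda>n. complex_of_real (bern n))"
  define F where "F = (fps_X\<^sup>2 + fps_const (4 * of_real pi ^ 2)) * ?B"
  have odd: "odd n" if "n \<notin> range ((*) 2)" for n :: nat
    using that by (auto elim!: evenE)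
  define u where "u n = (-1) ^ n * ((2 * pi) ^ (2 * n) * bern (2 * n))" for n
  have nth: "fps_nth F n = 4 * of_real pi ^ 2 * bern n + (if n < 2 then 0 else bern (n - 2))" for n
    by (simp add: F_def distrib_right fps_X_power_mult_nth)
  have sums: "(\<lambda>n. fps_nth F n * z ^ n) sums bern_aux z" if "norm z < 4 * pi" for z
    using bern_aux_fps bern_aux_holomorphic that unfolding F_def
    by (intro has_fps_expansion_imp_sums_complex[of _ _ "ereal (4 * pi)"]) auto
  \<comment> \<open>Adding the series at the two conjugate points cancels the odd terms and doubles
    the even ones.\<close>
  have "(\<lambda>n. fps_nth F n * ?a ^ n + fps_nth F n * (- ?a) ^ n) sums
          (bern_aux ?a + bern_aux (- ?a))"
    by (intro sums_add sums) (auto simp: norm_mult)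
  then have "(\<lambda>n. fps_nth F n * (?a ^ n + (- ?a) ^ n)) sums (- 16 * of_real pi ^ 2)"
    by (simp add: bern_aux_def power_mult_distrib distrib_left)
  then have S: "(\<lambda>n. fps_nth F (2 * n) * (?a ^ (2 * n) + (- ?a) ^ (2 * n))) sums (- 16 * of_real pi ^ 2)"
    by (subst (asm) sums_mono_reindex[of "\<lambda>n. 2 * n", symmetric])
       (auto simp: strict_mono_def odd)
  \<comment> \<open>Since \<open>?a\<close> squared is -4 pi^2, the contribution of
    \<open>bern (2 * n - 2)\<close> is that of \<open>u (n - 1)\<close> with a minus sign; for n = 0
    there is no predecessor.\<close>
  have E: "fps_nth F (2 * n) * (?a ^ (2 * n) + (- ?a) ^ (2 * n)) =
      of_real (8 * pi\<^sup>2 * (u n - (if n = 0 then 0 else u (n - 1))))" for n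
  proof -
    have a: "?a ^ (2 * n) = of_real ((-1) ^ n * (2 * pi) ^ (2 * n))" "(- ?a) ^ (2 * n) = ?a ^ (2 * n)"
      by (simp_all add: power_mult power_mult_distrib power_minus[of "4 * _"])
    have "(4 * pi\<^sup>2 * bern (2 * n) + (if n = 0 then 0 else bern (2 * (n - 1)))) *
        (2 * ((-1) ^ n * (2 * pi) ^ (2 * n))) = 8 * pi\<^sup>2 * (u n - (if n = 0 then 0 else u (n - 1)))"
      by (cases n) (auto simp: u_def algebra_simps power2_eq_square)
    then have "complex_of_real ((4 * pi\<^sup>2 * bern (2 * n) + (if n = 0 then 0 else bern (2 * (n - 1)))) *
        (2 * ((-1) ^ n * (2 * pi) ^ (2 * n)))) =
        of_real (8 * pi\<^sup>2 * (u n - (if n = 0 then 0 else u (n - 1))))"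
      by (rule arg_cong)
    then show ?thesis
      unfolding a nth by (cases n) (simp_all add: algebra_simps)
  qed
  have "(\<lambda>n. complex_of_real (8 * pi\<^sup>2 * (u n - (if n = 0 then 0 else u (n - 1)))))
      sums of_real (- 16 * pi\<^sup>2)"
    using S unfolding E by simp
  then have "(\<lambda>n. 8 * pi\<^sup>2 * (u n - (if n = 0 then 0 else u (n - 1)))) sums (- 16 * pi\<^sup>2)"
    by (subst (asm) sums_of_real_iff)
  from sums_divide[OF this, of "8 * pi\<^sup>2"]
  have "(\<lambda>n. u n - (if n = 0 then 0 else u (n - 1))) sums (- 2)" by simp
  \<comment> \<open>By telescoping, convergence of the series is convergence of u itself.\<close>
  moreover have "(\<Sum>k\<le>n. u k - (if k = 0 then 0 else u (k - 1))) = u n" for n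
    by (induction n) auto
  ultimately show ?thesis by (simp add: sums_def_le u_def)
qed

section \<open>Inner products of Bernoulli polynomials and shifted cosines\<close>

lemma integral_by_parts_01:
  fixes u v u' v' :: "real \<Rightarrow> real"
  assumes u: "\<And>x. (u has_real_derivative u' x) (at x)" and v: "\<And>x. (v has_real_derivative v' x) (at x)"
    and u': "continuous_on {0..1} u'" and v': "continuous_on {0..1} v'"
  shows "integral {0..1} (\<lambda>x. u x * v' x) = u 1 * v 1 - u 0 * v 0 - integral {0..1} (\<lambda>x. u' x * v x)"
proof -
  have c: "continuous_on {0..1} u" "continuous_on {0..1} v"
    using u v by (meson DERIV_isCont continuous_at_imp_continuous_on)+
  have "((\<lambda>x. u' x * v x + u x * v' x) has_integral (u 1 * v 1 - u 0 * v 0)) {0..1}"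
  proof (rule fundamental_theorem_of_calculus)
    fix x :: real
    have "((\<lambda>x. u x * v x) has_real_derivative u' x * v x + u x * v' x) (at x)"
      using u[of x] v[of x] by (auto intro!: derivative_eq_intros)
    then show "((\<lambda>x. u x * v x) has_vector_derivative u' x * v x + u x * v' x) (at x within {0..1})"
      by (simp add: has_field_derivative_at_within has_real_derivative_iff_has_vector_derivative[symmetric])
  qed simp
  moreover have "integral {0..1} (\<lambda>x. u' x * v x + u x * v' x) =
      integral {0..1} (\<lambda>x. u' x * v x) + integral {0..1} (\<lambda>x. u x * v' x)"
    by (intro Henstock_Kurzweil_Integration.integral_add integrable_continuous_real continuous_intros c u' v')
  ultimately show ?thesis by (simp add: integral_unique)
qed

lemma DERIV_bernoulli_p:
  "(poly (bernoulli_p (Suc n)) has_real_derivative poly (bernoulli_p n) x) (at x)"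
  using poly_DERIV[of "bernoulli_p (Suc n)" x] by (simp add: pderiv_bernoulli_p)

text \<open>Integration by parts lowers one index, raises the other and flips the sign; the boundary
  terms cancel for indices at least 2. At index 1 the unit jump of \<open>bernoulli_p 1\<close>
  leaves the Bernoulli number.\<close>

lemma integral_bernoulli_p_mult:
  "integral {0..1} (\<lambda>x. poly (bernoulli_p (Suc m)) x * poly (bernoulli_p (Suc n)) x)
     = (-1) ^ m * bern (m + n + 2)"
proof (induction m arbitrary: n)
  case 0
  show ?case
    using integral_by_parts_01[OF DERIV_bernoulli_p[of 0] DERIV_bernoulli_p[of "Suc n"]]
      bernoulli_p_at_1[of 0] bernoulli_p_at_1[of "Suc n"] integral_bernoulli_p[of "Suc n"]
    by (simp add: algebra_simps continuous_intros)
next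
  case (Suc m)
  show ?case
    using integral_by_parts_01[OF DERIV_bernoulli_p[of "Suc m"] DERIV_bernoulli_p[of "Suc n"]]
      bernoulli_p_at_1[of "Suc m"] bernoulli_p_at_1[of "Suc n"] Suc[of "Suc n"]
    by (simp add: continuous_intros)
qed

text \<open>The phase makes differentiation lower the index, up to a factor 2 pi, just as for
  \<open>bernoulli_p\<close>.\<close>

definition shifted_cos :: "nat \<Rightarrow> real \<Rightarrow> real" where
  "shifted_cos n x = cos (2 * pi * x - n * (pi / 2))"

lemma shifted_cos_Suc: "shifted_cos (Suc n) x = sin (2 * pi * x - n * (pi / 2))"
proof -
  have "2 * pi * x - Suc n * (pi / 2) = 2 * pi * x - n * (pi / 2) - pi / 2"
    by (simp add: field_simps)
  then show ?thesis by (simp only: shifted_cos_def cos_diff[of _ "pi / 2"]) simp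
qed

lemma shifted_cos_Suc_Suc: "shifted_cos (Suc (Suc n)) x = - shifted_cos n x"
proof -
  have "2 * pi * x - Suc (Suc n) * (pi / 2) = 2 * pi * x - n * (pi / 2) - pi"
    by (simp add: field_simps)
  then show ?thesis by (simp only: shifted_cos_def cos_minus_pi)
qed

lemma shifted_cos_even: "shifted_cos (2 * n) x = (-1) ^ n * cos (2 * pi * x)"
proof (induction n)
  case 0
  then show ?case by (simp add: shifted_cos_def)
next
  case (Suc n)
  then show ?case using shifted_cos_Suc_Suc[of "2 * n" x] by simp
qed

lemma shifted_cos_odd: "shifted_cos (Suc (2 * n)) x = (-1) ^ n * sin (2 * pi * x)"
proof (induction n)
  case 0
  then show ?case by (simp add: shifted_cos_Suc)
next
  case (Suc n)
  then show ?case using shifted_cos_Suc_Suc[of "Suc (2 * n)" x] by simp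
qed

lemma shifted_cos_periodic: "shifted_cos n 1 = shifted_cos n 0"
proof -
  have "shifted_cos n 1 = cos (- (n * (pi / 2)) + 2 * pi)" 
    by (simp add: shifted_cos_def algebra_simps)
  then show ?thesis by (simp only: cos_periodic) (simp add: shifted_cos_def)
qed

lemma DERIV_shifted_cos:
  "((\<lambda>x. shifted_cos (Suc n) x / (2 * pi)) has_real_derivative shifted_cos n x) (at x)"
proof -
  have "((\<lambda>x. sin (2 * pi * x - n * (pi / 2)) / (2 * pi)) has_real_derivative
      cos (2 * pi * x - n * (pi / 2))) (at x)"
    by (auto intro!: derivative_eq_intros)
  then show ?thesis unfolding shifted_cos_Suc by (simp only: shifted_cos_def)
qed

lemma continuous_on_shifted_cos [continuous_intros]: "continuous_on A (shifted_cos n)"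
  unfolding shifted_cos_def by (intro continuous_intros) auto

text \<open>Each integration by parts gains a factor 1/(2 pi); its minus sign is absorbed by
  \<open>shifted_cos_Suc_Suc\<close>. The base value comes from the unit jump of
  \<open>bernoulli_p 1\<close>.\<close>

lemma integral_bernoulli_p_shifted_cos:
  "integral {0..1} (\<lambda>x. poly (bernoulli_p (Suc n)) x * shifted_cos (Suc n) x) = - 1 / (2 * pi) ^ Suc n"
proof (induction n)
  case 0
  \<comment> \<open>The remaining integral in the base case is a mean over a full period.\<close>
  have "integral {0..1} (\<lambda>x. 1 * shifted_cos (Suc (Suc 0)) x) = 0"
    using integral_by_parts_01[OF DERIV_const[of 1] DERIV_shifted_cos[of "Suc (Suc 0)"]]
    by (simp add: shifted_cos_periodic continuous_intros)
  then show ?case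
    using integral_by_parts_01[OF DERIV_bernoulli_p[of 0] DERIV_shifted_cos[of "Suc 0"]]
      bernoulli_p_at_1[of 0] shifted_cos_periodic[of "Suc (Suc 0)"]
    by (simp add: continuous_intros shifted_cos_Suc_Suc field_simps) (simp add: shifted_cos_def)
next
  case (Suc n)
  let ?I = "\<lambda>n. integral {0..1} (\<lambda>x. poly (bernoulli_p (Suc n)) x * shifted_cos (Suc n) x)"
  have "?I (Suc n) = ?I n / (2 * pi)"
    using integral_by_parts_01[OF DERIV_bernoulli_p[of "Suc n"] DERIV_shifted_cos[of "Suc (Suc n)"]]
      bernoulli_p_at_1[of "Suc n"] shifted_cos_periodic[of "Suc (Suc (Suc n))"]
    by (simp add: continuous_intros shifted_cos_Suc_Suc[of "Suc n"])
  then show ?case unfolding Suc by simp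
qed

text \<open>Consecutive shifts are the cosine and sine of one argument, so their squares add up to
  1; integration by parts shows that both squares have the same integral.\<close>

lemma integral_shifted_cos_squared: "integral {0..1} (\<lambda>x. (shifted_cos n x)\<^sup>2) = 1 / 2"
proof -
  have "integral {0..1} (\<lambda>x. shifted_cos (Suc n) x * shifted_cos (Suc n) x) =
      integral {0..1} (\<lambda>x. shifted_cos n x * shifted_cos n x)"
    using integral_by_parts_01[OF DERIV_shifted_cos[of n] DERIV_shifted_cos[of "Suc n"]]
    by (simp add: continuous_intros shifted_cos_Suc_Suc shifted_cos_periodic)
  moreover have "(shifted_cos n x)\<^sup>2 + (shifted_cos (Suc n) x)\<^sup>2 = 1" for x
    by (simp add: shifted_cos_Suc) (simp add: shifted_cos_def)
  then have "integral {0..1} (\<lambda>x. (shifted_cos n x)\<^sup>2 + (shifted_cos (Suc n) x)\<^sup>2) = 1"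
    by simp
  moreover have "integral {0..1} (\<lambda>x. (shifted_cos n x)\<^sup>2 + (shifted_cos (Suc n) x)\<^sup>2) =
     integral {0..1} (\<lambda>x. (shifted_cos n x)\<^sup>2) + integral {0..1} (\<lambda>x. (shifted_cos (Suc n) x)\<^sup>2)"
    by (intro Henstock_Kurzweil_Integration.integral_add integrable_continuous_real continuous_intros)
  ultimately show ?thesis by (simp add: power2_eq_square)
qed

section \<open>Decay of the remainder after the leading Fourier term\<close>

text \<open>The leading Fourier term of the scaled polynomial is \<open>- 2 * shifted_cos n\<close>,
  so subtracting it gives a plus sign.\<close>

definition bern_remainder :: "nat \<Rightarrow> real \<Rightarrow> real" where
  "bern_remainder n x = (2 * pi) ^ n * poly (bernoulli_p n) x + 2 * shifted_cos n x"

lemma continuous_on_bern_remainder [continuous_intros]: "continuous_on A (bern_remainder n)"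
  unfolding bern_remainder_def by (intro continuous_intros)

lemma integral_bern_remainder_squared:
  "integral {0..1} (\<lambda>x. (bern_remainder (Suc n) x)\<^sup>2) =
     (-1) ^ n * ((2 * pi) ^ (2 * Suc n) * bern (2 * Suc n)) - 2"
proof -
  let ?p = "poly (bernoulli_p (Suc n))" and ?c = "shifted_cos (Suc n)" and ?k = "(2 * pi) ^ Suc n"
  have I: "(f has_integral integral {0..1} f) {0..1}" if "continuous_on {0..1} f" for f :: "real \<Rightarrow> real"
    using that by (intro integrable_integral integrable_continuous_real)
  have "((\<lambda>x. ?p x * ?p x) has_integral (-1) ^ n * bern (2 * Suc n)) {0..1}"
    using I[of "\<lambda>x. ?p x * ?p x"] integral_bernoulli_p_mult[of n n]
    by (simp add: continuous_intros mult_2)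
  moreover have "((\<lambda>x. ?p x * ?c x) has_integral - 1 / ?k) {0..1}"
    using I[of "\<lambda>x. ?p x * ?c x"] unfolding integral_bernoulli_p_shifted_cos
    by (simp only: continuous_intros)
  moreover have "((\<lambda>x. (?c x)\<^sup>2) has_integral 1 / 2) {0..1}"
    using I[of "\<lambda>x. (?c x)\<^sup>2"] unfolding integral_shifted_cos_squared
    by (simp only: continuous_intros)
  \<comment> \<open>The cross term contributes -4 and the squared cosine 2, which together give the
    -2 of the claim.\<close>
  ultimately have "((\<lambda>x. ?k\<^sup>2 * (?p x * ?p x) + 4 * ?k * (?p x * ?c x) + 4 * (?c x)\<^sup>2) has_integral
      ?k\<^sup>2 * ((-1) ^ n * bern (2 * Suc n)) + 4 * ?k * (- 1 / ?k) + 4 * (1 / 2)) {0..1}"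
    by (intro has_integral_add has_integral_mult_right)
  moreover have "(\<lambda>x. ?k\<^sup>2 * (?p x * ?p x) + 4 * ?k * (?p x * ?c x) + 4 * (?c x)\<^sup>2) =
      (\<lambda>x. (bern_remainder (Suc n) x)\<^sup>2)"
    by (simp add: bern_remainder_def power2_eq_square algebra_simps del: power_Suc)
  moreover have "?k\<^sup>2 = (2 * pi) ^ (2 * Suc n)"
    by (simp only: power_mult[symmetric] mult.commute)
  moreover have "4 * ?k * (- 1 / ?k) = - 4" by simp
  ultimately show ?thesis by (simp only: integral_unique) simp
qed

text \<open>Cauchy-Schwarz against the constant 1, derived from the nonnegative variance of |f|
  about its mean.\<close>

lemma integral_abs_le_sqrt:
  fixes f :: "real \<Rightarrow> real"
  assumes "continuous_on {0..1} f"
  shows "integral {0..1} (\<lambda>x. \<bar>f x\<bar>) \<le> sqrt (integral {0..1} (\<lambda>x. (f x)\<^sup>2))"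
proof -
  let ?m = "integral {0..1} (\<lambda>x. \<bar>f x\<bar>)"
  have "0 \<le> integral {0..1} (\<lambda>x. (\<bar>f x\<bar> - ?m)\<^sup>2)"
    by (rule Henstock_Kurzweil_Integration.integral_nonneg)
       (auto intro!: integrable_continuous_real continuous_intros assms)
  also have "(\<lambda>x. (\<bar>f x\<bar> - ?m)\<^sup>2) = (\<lambda>x. (f x)\<^sup>2 - 2 * ?m * \<bar>f x\<bar> + ?m\<^sup>2)"
    by (simp add: power2_diff algebra_simps)
  also have "integral {0..1} \<dots> = integral {0..1} (\<lambda>x. (f x)\<^sup>2) - 2 * ?m * ?m + ?m\<^sup>2 * (1 - 0)"
    by (intro integral_unique has_integral_add has_integral_diff has_integral_mult_right
          integrable_integral integrable_continuous_real continuous_intros assms)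
       (use has_integral_const_real[of "?m\<^sup>2" 0 1] in simp)
  finally show ?thesis by (intro real_le_rsqrt) (simp add: power2_eq_square)
qed

lemma bern_remainder_tendsto_0:
  "(\<lambda>n. integral {0..1} (\<lambda>x. \<bar>bern_remainder n x\<bar>)) \<longlonglongrightarrow> 0"
proof (rule LIMSEQ_imp_Suc)
  \<comment> \<open>The sign exponent is n while the Bernoulli index is that of n + 1, so the limit
    -2 enters negated.\<close>
  have "(\<lambda>n. (-1) ^ n * ((2 * pi) ^ (2 * Suc n) * bern (2 * Suc n)) - 2) \<longlonglongrightarrow> - (- 2) - 2"
    using LIMSEQ_Suc[OF bern_even_tendsto]
    by (intro tendsto_diff tendsto_const) (simp add: tendsto_minus_cancel_left)
  from tendsto_real_sqrt[OF this]
  have "(\<lambda>n. sqrt (integral {0..1} (\<lambda>x. (bern_remainder (Suc n) x)\<^sup>2))) \<longlonglongrightarrow> 0"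
    unfolding integral_bern_remainder_squared by simp
  then show "(\<lambda>n. integral {0..1} (\<lambda>x. \<bar>bern_remainder (Suc n) x\<bar>)) \<longlonglongrightarrow> 0"
    by (rule tendsto_sandwich[OF _ _ tendsto_const, rotated 2])
       (auto intro!: always_eventually integral_abs_le_sqrt continuous_intros
          Henstock_Kurzweil_Integration.integral_nonneg integrable_continuous_real)
qed

section \<open>Norm of the cosine and comparison of L1 norms\<close>

text \<open>By parity of n the integrand is |cos| or |sin|; the interval is split at the sign
  changes.\<close>

lemma integral_abs_shifted_cos: "integral {0..1} (\<lambda>x. \<bar>shifted_cos n x\<bar>) = 2 / pi"
proof (cases "even n")
  case True
  then obtain m where n: "n = 2 * m" by (elim evenE)
  let ?F = "\<lambda>x. sin (2 * pi * x) / (2 * pi)"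
  have F: "(?F has_vector_derivative cos (2 * pi * x)) (at x within A)" for x A
    unfolding has_real_derivative_iff_has_vector_derivative[symmetric]
    by (auto intro!: derivative_eq_intros)
  have 1: "((\<lambda>x. \<bar>cos (2 * pi * x)\<bar>) has_integral (?F (1/4) - ?F 0)) {0..1/4}"
  proof (rule has_integral_eq[OF _ fundamental_theorem_of_calculus[OF _ F]])
    fix x :: real assume "x \<in> {0..1/4}"
    moreover from this have "0 \<le> pi * (x * 4)" by simp
    then have "- pi \<le> pi * (x * 4)" using pi_gt_zero by linarith
    ultimately have "cos (2 * pi * x) \<ge> 0" by (intro cos_ge_zero) (auto simp: field_simps)
    then show "cos (2 * pi * x) = \<bar>cos (2 * pi * x)\<bar>" by simp
  qed simp
  have 2: "((\<lambda>x. \<bar>cos (2 * pi * x)\<bar>) has_integral - (?F (3/4) - ?F (1/4))) {1/4..3/4}"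
  proof (rule has_integral_eq[OF _ has_integral_neg[OF fundamental_theorem_of_calculus[OF _ F]]])
    fix x :: real assume "x \<in> {1/4..3/4}"
    \<comment> \<open>The shift by pi moves the argument into [-pi/2, pi/2] and reverses the sign of
      the cosine.\<close>
    then have "cos (2 * pi * x - pi) \<ge> 0" by (intro cos_ge_zero) (auto simp: field_simps)
    then show "- cos (2 * pi * x) = \<bar>cos (2 * pi * x)\<bar>" by simp
  qed simp
  have 3: "((\<lambda>x. \<bar>cos (2 * pi * x)\<bar>) has_integral (?F 1 - ?F (3/4))) {3/4..1}"
  proof (rule has_integral_eq[OF _ fundamental_theorem_of_calculus[OF _ F]])
    fix x :: real assume "x \<in> {3/4..1}"
    then have "cos (2 * pi * x - 2 * pi) \<ge> 0" by (intro cos_ge_zero) (auto simp: field_simps)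
    then show "cos (2 * pi * x) = \<bar>cos (2 * pi * x)\<bar>" by (simp add: cos_diff)
  qed simp
  have s: "sin (pi * 3 / 2) = - 1" using sin_3over2_pi by (simp add: mult.commute)
  have "((\<lambda>x. \<bar>cos (2 * pi * x)\<bar>) has_integral 2 / pi) {0..1}"
    using has_integral_combine[OF _ _ has_integral_combine[OF _ _ 1 2] 3] 
    by (simp add: s field_simps)
  then show ?thesis by (simp add: n shifted_cos_even abs_mult integral_unique)
next
  case False
  then obtain m where n: "n = Suc (2 * m)" by (auto elim: oddE)
  let ?F = "\<lambda>x. - cos (2 * pi * x) / (2 * pi)"
  have F: "(?F has_vector_derivative sin (2 * pi * x)) (at x within A)" for x A
    unfolding has_real_derivative_iff_has_vector_derivative[symmetric]
    by (auto intro!: derivative_eq_intros)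
  have 1: "((\<lambda>x. \<bar>sin (2 * pi * x)\<bar>) has_integral (?F (1/2) - ?F 0)) {0..1/2}"
  proof (rule has_integral_eq[OF _ fundamental_theorem_of_calculus[OF _ F]])
    fix x :: real assume "x \<in> {0..1/2}"
    then have "sin (2 * pi * x) \<ge> 0" by (intro sin_ge_zero) (auto simp: field_simps)
    then show "sin (2 * pi * x) = \<bar>sin (2 * pi * x)\<bar>" by simp
  qed simp
  have 2: "((\<lambda>x. \<bar>sin (2 * pi * x)\<bar>) has_integral - (?F 1 - ?F (1/2))) {1/2..1}"
  proof (rule has_integral_eq[OF _ has_integral_neg[OF fundamental_theorem_of_calculus[OF _ F]]])
    fix x :: real assume "x \<in> {1/2..1}"
    then have "sin (2 * pi * x - pi) \<ge> 0" by (intro sin_ge_zero) (auto simp: field_simps)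
    then show "- sin (2 * pi * x) = \<bar>sin (2 * pi * x)\<bar>" by simp
  qed simp
  have "((\<lambda>x. \<bar>sin (2 * pi * x)\<bar>) has_integral 2 / pi) {0..1}"
    using has_integral_combine[OF _ _ 1 2] by (simp add: field_simps)
  then show ?thesis by (simp add: n shifted_cos_odd abs_mult integral_unique)
qed

text \<open>The reverse triangle inequality, applied pointwise and integrated.\<close>

lemma integral_abs_diff_le:
  fixes f g h :: "real \<Rightarrow> real"
  assumes "continuous_on {0..1} f" "continuous_on {0..1} g" "continuous_on {0..1} h"
    and "\<And>x. x \<in> {0..1} \<Longrightarrow> \<bar>f x - g x\<bar> \<le> h x"
  shows "\<bar>integral {0..1} (\<lambda>x. \<bar>f x\<bar>) - integral {0..1} (\<lambda>x. \<bar>g x\<bar>)\<bar> \<le> integral {0..1} h"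
proof -
  have "norm (integral {0..1} (\<lambda>x. \<bar>f x\<bar> - \<bar>g x\<bar>)) \<le> integral {0..1} h"
  proof (rule integral_norm_bound_integral)
    fix x :: real assume "x \<in> {0..1}"
    then show "norm (\<bar>f x\<bar> - \<bar>g x\<bar>) \<le> h x" using assms(4)[of x] by simp
  qed (auto intro!: integrable_continuous_real continuous_intros assms)
  then show ?thesis
    by (subst (asm) Henstock_Kurzweil_Integration.integral_diff)
       (auto intro!: integrable_continuous_real continuous_intros assms)
qed

section \<open>Limits of the scaled norms and the asymptotics\<close>

text \<open>The limit is the norm of \<open>2 * shifted_cos n\<close>, and the error is at most the
  norm of the remainder.\<close>

lemma L1_norm_bernoulli_p_tendsto: "(\<lambda>n. (2 * pi) ^ n * poly_L1_norm (bernoulli_p n)) \<longlonglongrightarrow> 4 / pi"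
proof -
  have *: "\<bar>(2 * pi) ^ n * poly_L1_norm (bernoulli_p n) - 4 / pi\<bar>
      \<le> integral {0..1} (\<lambda>x. \<bar>bern_remainder n x\<bar>)" for n
  proof -
    have "\<bar>integral {0..1} (\<lambda>x. \<bar>(2 * pi) ^ n * poly (bernoulli_p n) x\<bar>)
        - integral {0..1} (\<lambda>x. \<bar>- 2 * shifted_cos n x\<bar>)\<bar> \<le> integral {0..1} (\<lambda>x. \<bar>bern_remainder n x\<bar>)"
      by (rule integral_abs_diff_le) (auto intro!: continuous_intros simp: bern_remainder_def)
    then show ?thesis
      by (simp add: abs_mult poly_L1_norm_def integral_abs_shifted_cos)
  qed
  show ?thesis
    by (rule LIM_zero_cancel, rule Lim_null_comparison[OF _ bern_remainder_tendsto_0])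
       (simp only: real_norm_def * eventually_True)
qed

text \<open>The scaled constant term approaches -2 (-1)^n, so the scaled
  \<open>bernoulli_q (2 * n)\<close> approaches (-1)^n (2 - 2 cos(2 pi x)). As 2 - 2 cos is
  nonnegative, the norm of this limit is its mean 2.\<close>

lemma L1_norm_bernoulli_q_tendsto:
  "(\<lambda>n. (2 * pi) ^ (2 * n) * poly_L1_norm (bernoulli_q (2 * n))) \<longlonglongrightarrow> 2"
proof -
  define \<beta> where "\<beta> n = (2 * pi) ^ (2 * n) * bern (2 * n)" for n
  \<comment> \<open>The error bound: the remainder of the polynomial plus the deviation of the
    scaled Bernoulli number from its limit.\<close>
  define e where "e n = integral {0..1} (\<lambda>x. \<bar>bern_remainder (2 * n) x\<bar>) + \<bar>(-1) ^ n * \<beta> n + 2\<bar>" for n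
  have q: "poly (bernoulli_q n) x = poly (bernoulli_p n) x - bern n" for n x
    by (simp add: bernoulli_q_def bernoulli_p_def bernoulli_number_def)
  have "((\<lambda>x. 2 - 2 * cos (2 * pi * x)) has_integral
      ((2 * 1 - sin (2 * pi * 1) / pi) - (2 * 0 - sin (2 * pi * 0) / pi))) {0..1}"
    by (rule fundamental_theorem_of_calculus)
       (auto intro!: derivative_eq_intros simp: has_real_derivative_iff_has_vector_derivative[symmetric])
  moreover have "\<bar>2 - 2 * cos (2 * pi * x)\<bar> = 2 - 2 * cos (2 * pi * x)" for x
    using cos_le_one[of "2 * pi * x"] by linarith
  ultimately have I: "integral {0..1} (\<lambda>x. \<bar>(-1) ^ n * (2 - 2 * cos (2 * pi * x))\<bar>) = 2" for n :: nat
    by (simp add: abs_mult integral_unique)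
  have *: "\<bar>(2 * pi) ^ (2 * n) * poly_L1_norm (bernoulli_q (2 * n)) - 2\<bar> \<le> e n" for n
  proof -
    have "\<bar>integral {0..1} (\<lambda>x. \<bar>(2 * pi) ^ (2 * n) * poly (bernoulli_q (2 * n)) x\<bar>)
        - integral {0..1} (\<lambda>x. \<bar>(-1) ^ n * (2 - 2 * cos (2 * pi * x))\<bar>)\<bar>
        \<le> integral {0..1} (\<lambda>x. \<bar>bern_remainder (2 * n) x\<bar> + \<bar>(-1) ^ n * \<beta> n + 2\<bar>)"
    proof (rule integral_abs_diff_le)
      fix x :: real
      \<comment> \<open>Multiplying by (-1)^n removes the alternating sign from both the cosine and
        the limit of \<open>\<beta>\<close>.\<close>
      have "(-1) ^ n * (2 * pi) ^ (2 * n) * poly (bernoulli_q (2 * n)) x - (2 - 2 * cos (2 * pi * x)) =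
          (-1) ^ n * bern_remainder (2 * n) x - ((-1) ^ n * \<beta> n + 2)"
        unfolding q bern_remainder_def shifted_cos_even \<beta>_def
        by (cases "even n") (simp_all add: algebra_simps)
      then show "\<bar>(2 * pi) ^ (2 * n) * poly (bernoulli_q (2 * n)) x - (-1) ^ n * (2 - 2 * cos (2 * pi * x))\<bar>
          \<le> \<bar>bern_remainder (2 * n) x\<bar> + \<bar>(-1) ^ n * \<beta> n + 2\<bar>"
        by (cases "even n") auto
    qed (auto intro!: continuous_intros)
    also have "\<dots> = e n"
      unfolding e_def by (subst Henstock_Kurzweil_Integration.integral_add)
        (auto intro!: integrable_continuous_real continuous_intros)
    finally show ?thesis unfolding I by (simp add: abs_mult poly_L1_norm_def)
  qed
  have "(\<lambda>n. integral {0..1} (\<lambda>x. \<bar>bern_remainder (2 * n) x\<bar>)) \<longlonglongrightarrow> 0"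
    using LIMSEQ_subseq_LIMSEQ[OF bern_remainder_tendsto_0, of "\<lambda>n. 2 * n"]
    by (simp add: o_def strict_mono_def)
  from tendsto_add[OF this, of "\<lambda>n. \<bar>(-1) ^ n * \<beta> n + 2\<bar>" "\<bar>- 2 + 2\<bar>"]
  have "e \<longlonglongrightarrow> 0" if "(\<lambda>n. \<bar>(-1) ^ n * \<beta> n + 2\<bar>) \<longlonglongrightarrow> \<bar>- 2 + 2\<bar>"
    using that unfolding e_def by simp
  moreover have "(\<lambda>n. \<bar>(-1) ^ n * \<beta> n + 2\<bar>) \<longlonglongrightarrow> \<bar>- 2 + 2\<bar>"
    unfolding \<beta>_def by (intro tendsto_intros bern_even_tendsto)
  ultimately have "e \<longlonglongrightarrow> 0" by blast
  then show ?thesis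
    by (intro LIM_zero_cancel[of _ 2], rule Lim_null_comparison[of _ e, rotated])
       (simp_all only: real_norm_def * eventually_True)
qed

theorem mainTheorem9:
  "((\<lambda>n. poly_L1_norm (bernoulli_p n)) \<sim>[at_top] (\<lambda>n. 8 / (2 * pi) ^ (n + 1))) \<and>
   ((\<lambda>n. poly_L1_norm (bernoulli_q (2 * n))) \<sim>[at_top] (\<lambda>n. 2 / (2 * pi) ^ (2 * n)))"
proof (intro conjI asymp_equivI')
  show "(\<lambda>n. poly_L1_norm (bernoulli_p n) / (8 / (2 * pi) ^ (n + 1))) \<longlonglongrightarrow> 1"
    \<comment> \<open>Here 8/(2 pi)^(n+1) = (4/pi)/(2 pi)^n, hence the factor pi/4.\<close>
    using tendsto_mult_right[OF L1_norm_bernoulli_p_tendsto, of "pi / 4"] by (simp add: field_simps)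
  show "(\<lambda>n. poly_L1_norm (bernoulli_q (2 * n)) / (2 / (2 * pi) ^ (2 * n))) \<longlonglongrightarrow> 1"
    using tendsto_mult_right[OF L1_norm_bernoulli_q_tendsto, of "1 / 2"] by (simp add: field_simps)
qed

end
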